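(* Let $f=f_1+f_2$ on $\mathbb{R}^m$ and $g=g_1+g_2$ on $\mathbb{R}^n$, where $f_1:\mathbb{R}^m\to\mathbb{R}\cup\{+\infty\}$ is proper, closed and convex; $f_2:\mathbb{R}^m\to\mathbb{R}$ is convex with $L_{f_2}$-Lipschitz continuous gradient; $g_1:\mathbb{R}^n\to\mathbb{R}\cup\{+\infty\}$ is proper, closed and $\mu_g$-strongly convex ($\mu_g>0$); $g_2:\mathbb{R}^n\to\mathbb{R}$ is convex with $L_{g_2}$-Lipschitz continuous gradient. Let $A\in\mathbb{R}^{p\times m}$, $B\in\mathbb{R}^{p\times n}$, $b\in\mathbb{R}^p$, let $\mathcal{L}(x,y,\lambda)=f(x)+g(y)+\langle\lambda,Ax+By-b\rangle$, and suppose its set of saddle points $\Omega$ is nonempty. Let $\{(x_k,y_k)\}_{k\ge1}$ be generated by Algorithm 2 (described in the context) with parameters $\alpha,\beta,\gamma>0$, and let $(x^*,y^*,\lambda^* )\in\Omega$. Assume $\alpha\le \frac{1}{L_{f_2}}$, $\beta\le\frac{t_1^2}{L_{g_2}+t_1^2\gamma\|B\|^2}$, and that $\{t_k\}_{k\ge1}\subseteq[1,+\infty)$ is a nondecreasing sequence satisfying, for all $k\ge1$, $$t_{k+1}^2\le t_k^2+t_{k+1}\quad\text{and}\quad t_{k+1}^2\le t_k^2+\beta\mu_g t_k .$$ Then for all $k\ge1$: $$\mathcal{L}(x_k,y_k,\lambda^* )-\mathcal{L}(x^*,y^*,\lambda^* )\le\frac{\mathcal{E}_1}{t_k^2},\qquad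 \|Ax_k+By_k-b\|\le\frac{C_2}{t_k^2},$$ $$|f(x_k)+g(y_k)-f(x^* )-g(y^* )|\le\frac{\mathcal{E}_1+C_2\|\lambda^*\|}{t_k^2},$$ where $$\mathcal{E}_1=t_1^2\big(\mathcal{L}(x_1,y_1,\lambda^* )-\mathcal{L}(x^*,y^*,\lambda^* )\big)+\frac{1}{2\alpha}\|x_1-x^*\|^2+\frac{t_2^2}{2\beta}\|y_1-y^*\|^2+\frac{1}{2\gamma}\|\lambda_1-\lambda^*\|^2,$$ $$C_2=3t_1^2\|Ax_1+By_1-b\|+\frac{2\|\lambda_1-\lambda^*\|+2\sqrt{2\gamma\mathcal{E}_1}}{\gamma}.$$
   Context: Norms are Euclidean (operator norm for matrices). $dom(F)=\{x: F(x)<+\infty\}$; $F$ is proper if $dom(F)\ne\emptyset$; $F$ is closed if $F(x)\le\liminf_{y\to x}F(y)$ for all $x$ and $dom(F)$ is closed. $1/0$ is read as $+\infty$ in step-size bounds. $\mu_g$-strong convexity of $g_1$ means $g_1(y_2)-g_1(y_1)-\langle\xi,y_2-y_1\rangle\ge\frac{\mu_g}{2}\|y_2-y_1\|^2$ for all $y_1,y_2$ and $\xi\in\partial g_1(y_1)$. A saddle point is a triple $(x^*,y^*,\lambda^* )$ with $\mathcal{L}(x^*,y^*,\lambda)\le\mathcal{L}(x^*,y^*,\lambda^* )\le\mathcal{L}(x,y,\lambda^* )$ for all $(x,y,\lambda)$. The proximal operator is $\mathbf{Prox}_{s,h}(z)=\arg\min_x h(x)+\frac{1}{2s}\|x-z\|^2$.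 Algorithm 2 (for $\min f(x)+g(y)$ s.t. $Ax+By=b$). Initialize $x_1=x_0=u_1\in dom(f)$, $y_1=y_0=v_1\in dom(g)$, $\lambda_1\in\mathbb{R}^p$. For $k=1,2,\dots$: - $(\bar x_k,\bar y_k)=(x_k,y_k)+\frac{t_k-1}{t_{k+1}}[(x_k,y_k)-(x_{k-1},y_{k-1})]$; - $x_{k+1}=\arg\min_x\big(f_1(x)+\langle A^T\lambda_k+\nabla f_2(\bar x_k),x\rangle+\frac{\gamma t_{k+1}^2}{2}\|A(x-x_k)+\frac{1}{t_{k+1}}(Ax_k+Bv_k-b)\|^2+\frac{1}{2\alpha}\|x-\bar x_k\|^2\big)$; - $u_{k+1}=x_{k+1}+(t_{k+1}-1)(x_{k+1}-x_k)$; - $\bar\lambda_{k+1}=\lambda_k+\gamma t_{k+1}(Au_{k+1}+Bv_k-b)$; - $\eta_k=\frac{\beta}{t_{k+1}^2+\beta\mu_g(t_{k+1}-1)}$; - $y_{k+1}=\mathbf{Prox}_{\eta_k,g_1}\big(\bar y_k-\eta_k(\mu_g(t_{k+1}-1)(\bar y_k-y_k)+B^T\bar\lambda_{k+1}+\nabla g_2(\bar y_k))\big)$; - $v_{k+1}=y_{k+1}+(t_{k+1}-1)(y_{k+1}-y_k)$; - $\lambda_{k+1}=\lambda_k+\gamma t_{k+1}(Au_{k+1}+Bv_{k+1}-b)$. *)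

theory Defs
  imports "HOL-Analysis.Analysis"
begin

text \<open>
  Functions with values in \<open>\<real> \<union> {+\<infinity>}\<close> are functions into \<^typ>\<open>ereal\<close>; that they omit the
  value \<open>-\<infinity>\<close> is stated separately as a hypothesis where it is needed.
\<close>

definition edom :: "('a \<Rightarrow> ereal) \<Rightarrow> 'a set" where
  "edom F = {x. F x < \<infinity>}"

definition proper_fun :: "('a \<Rightarrow> ereal) \<Rightarrow> bool" where
  "proper_fun F \<longleftrightarrow> edom F \<noteq> {}"

text \<open>Lower semicontinuity together with closedness of the domain; this is stronger than
  closedness of the epigraph.\<close>

definition closed_fun :: "('a::topological_space \<Rightarrow> ereal) \<Rightarrow> bool" where
  "closed_fun F \<longleftrightarrow> (\<forall>x. F x \<le> Liminf (at x) F) \<and> closed (edom F)"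

text \<open>The endpoints are harmless because \<open>0 * \<infinity> = 0\<close> in \<^typ>\<open>ereal\<close>.\<close>

definition convex_fun :: "('a::real_vector \<Rightarrow> ereal) \<Rightarrow> bool" where
  "convex_fun F \<longleftrightarrow>
    (\<forall>x y u v. 0 \<le> u \<longrightarrow> 0 \<le> v \<longrightarrow> u + v = 1 \<longrightarrow>
      F (u *\<^sub>R x + v *\<^sub>R y) \<le> ereal u * F x + ereal v * F y)"

definition subdifferential :: "('a::real_inner \<Rightarrow> ereal) \<Rightarrow> 'a \<Rightarrow> 'a set" where
  "subdifferential F x = {\<xi>. x \<in> edom F \<and> (\<forall>y. F x + ereal (\<xi> \<bullet> (y - x)) \<le> F y)}"

text \<open>Convexity is demanded explicitly: the subgradient inequality alone would hold vacuously for
  a function without subgradients.\<close>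

definition strongly_convex_fun :: "real \<Rightarrow> ('a::real_inner \<Rightarrow> ereal) \<Rightarrow> bool" where
  "strongly_convex_fun \<mu> F \<longleftrightarrow> convex_fun F \<and>
    (\<forall>y1 y2. \<forall>\<xi>\<in>subdifferential F y1.
      F y2 - F y1 - ereal (\<xi> \<bullet> (y2 - y1)) \<ge> ereal (\<mu> / 2 * (norm (y2 - y1))\<^sup>2))"

definition grad :: "('a::real_inner \<Rightarrow> real) \<Rightarrow> 'a \<Rightarrow> 'a" where
  "grad h x = (THE D. GDERIV h x :> D)"

lemma grad_eqI:
  assumes "GDERIV h x :> D"
  shows "grad h x = D"
proof -
  have "D' = D" if "GDERIV h x :> D'" for D'
  proof -
    have "(\<lambda>v. v \<bullet> D') = (\<lambda>v. v \<bullet> D)"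
      using that assms unfolding gderiv_def by (rule has_derivative_unique)
    then show ?thesis
      by (metis inner_commute vector_eq_rdot)
  qed
  with assms show ?thesis
    unfolding grad_def by blast
qed

definition lipschitz_gradient :: "real \<Rightarrow> ('a::real_inner \<Rightarrow> real) \<Rightarrow> bool" where
  "lipschitz_gradient L h \<longleftrightarrow> (\<forall>x. GDERIV h x :> grad h x) \<and> L-lipschitz_on UNIV (grad h)"

definition argmin_set :: "('a \<Rightarrow> ereal) \<Rightarrow> 'a set" where
  "argmin_set F = {x. is_arg_min F (\<lambda>_. True) x}"

definition prox :: "real \<Rightarrow> ('a::real_normed_vector \<Rightarrow> ereal) \<Rightarrow> 'a \<Rightarrow> 'a set" where
  "prox s h z = argmin_set (\<lambda>x. h x + ereal (1 / (2 * s) * (norm (x - z))\<^sup>2))"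

definition lagrangian ::
  "(real^'m \<Rightarrow> ereal) \<Rightarrow> (real^'n \<Rightarrow> ereal) \<Rightarrow> real^'m^'p \<Rightarrow> real^'n^'p \<Rightarrow> real^'p \<Rightarrow>
    real^'m \<Rightarrow> real^'n \<Rightarrow> real^'p \<Rightarrow> ereal" where
  "lagrangian f g A B b x y l = f x + g y + ereal (l \<bullet> (A *v x + B *v y - b))"

definition saddle_points :: "('x \<Rightarrow> 'y \<Rightarrow> 'l \<Rightarrow> ereal) \<Rightarrow> ('x \<times> 'y \<times> 'l) set" where
  "saddle_points \<L> = {(xs, ys, ls).
    \<forall>x y l. \<L> xs ys l \<le> \<L> xs ys ls \<and> \<L> xs ys ls \<le> \<L> x y ls}"

text \<open>
  The sequences \<open>x\<close>, \<open>y\<close> are indexed from 0 and \<open>u\<close>, \<open>v\<close>, \<open>l\<close>, \<open>t\<close> from 1; \<open>l\<close> is the multiplier.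
  The minimisers are given by membership in a set of minimisers. Under the hypotheses for which the
  iteration is used both subproblems are strongly convex, so these sets are singletons.
\<close>

definition generated_by_algorithm ::
  "(real^'m \<Rightarrow> ereal) \<Rightarrow> (real^'m \<Rightarrow> real) \<Rightarrow> (real^'n \<Rightarrow> ereal) \<Rightarrow> (real^'n \<Rightarrow> real) \<Rightarrow>
    real^'m^'p \<Rightarrow> real^'n^'p \<Rightarrow> real^'p \<Rightarrow> real \<Rightarrow> real \<Rightarrow> real \<Rightarrow> real \<Rightarrow> (nat \<Rightarrow> real) \<Rightarrow>
    (nat \<Rightarrow> real^'m) \<Rightarrow> (nat \<Rightarrow> real^'n) \<Rightarrow> (nat \<Rightarrow> real^'m) \<Rightarrow> (nat \<Rightarrow> real^'n) \<Rightarrow>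
    (nat \<Rightarrow> real^'p) \<Rightarrow> bool" where
  "generated_by_algorithm f1 f2 g1 g2 A B b \<mu>g \<alpha> \<beta> \<gamma> t x y u v l \<longleftrightarrow>
    x 1 = x 0 \<and> x 0 = u 1 \<and> u 1 \<in> edom (\<lambda>z. f1 z + ereal (f2 z)) \<and>
    y 1 = y 0 \<and> y 0 = v 1 \<and> v 1 \<in> edom (\<lambda>z. g1 z + ereal (g2 z)) \<and>
    (\<forall>k\<ge>1.
      let xb = x k + ((t k - 1) / t (k+1)) *\<^sub>R (x k - x (k-1));
          yb = y k + ((t k - 1) / t (k+1)) *\<^sub>R (y k - y (k-1));
          lb = l k + (\<gamma> * t (k+1)) *\<^sub>R (A *v u (k+1) + B *v v k - b);
          \<eta> = \<beta> / ((t (k+1))\<^sup>2 + \<beta> * \<mu>g * (t (k+1) - 1))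
      in
        x (k+1) \<in> argmin_set (\<lambda>z. f1 z + ereal (
            (transpose A *v l k + grad f2 xb) \<bullet> z
            + \<gamma> * (t (k+1))\<^sup>2 / 2 *
                (norm (A *v (z - x k) + (1 / t (k+1)) *\<^sub>R (A *v x k + B *v v k - b)))\<^sup>2
            + 1 / (2 * \<alpha>) * (norm (z - xb))\<^sup>2)) \<and>
        u (k+1) = x (k+1) + (t (k+1) - 1) *\<^sub>R (x (k+1) - x k) \<and>
        y (k+1) \<in> prox \<eta> g1
            (yb - \<eta> *\<^sub>R ((\<mu>g * (t (k+1) - 1)) *\<^sub>R (yb - y k) + transpose B *v lb + grad g2 yb)) \<and>
        v (k+1) = y (k+1) + (t (k+1) - 1) *\<^sub>R (y (k+1) - y k) \<and>
        l (k+1) = l k + (\<gamma> * t (k+1)) *\<^sub>R (A *v u (k+1) + B *v v (k+1) - b))"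

end

(*  The energy
      t_k^2 (L(x_k, y_k, ls) - L(xs, ys, ls)) + |u_k - xs|^2 / (2 alpha)
        + t_{k+1}^2 |v_k - ys|^2 / (2 beta) + |l_k - ls|^2 / (2 gamma)
    is nonincreasing in k.  Both subproblems satisfy the same descent inequality, with modulus 0 for
    x; adding it at the saddle point with weight t and at the previous iterate with weight
    t (t - 1), where t = t_{k+1}, makes the distances telescope.  The monotone energy bounds the
    Lagrangian gap and the multipliers.  The multiplier update writes the increments of l_k through
    t_k^2 (A x_k + B y_k - b), and a convex-combination argument turns boundedness of l_k into
    boundedness of these vectors. *)
theory Submission
  imports Defs
begin

section \<open>First-order inequalities for differentiable functions\<close>

lemma gderiv_direction:
  fixes h :: "'a::real_inner \<Rightarrow> real"
  assumes "GDERIV h (x + s *\<^sub>R d) :> D"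
  shows "((\<lambda>s. h (x + s *\<^sub>R d)) has_real_derivative d \<bullet> D) (at s within S)"
proof -
  have "((\<lambda>s. h (x + s *\<^sub>R d)) has_derivative (\<lambda>r. (r *\<^sub>R d) \<bullet> D)) (at s within S)"
  proof (rule has_derivative_compose[where g = h, unfolded o_def])
    show "((\<lambda>s. x + s *\<^sub>R d) has_derivative (\<lambda>r. r *\<^sub>R d)) (at s within S)"
      by (auto intro!: derivative_eq_intros)
    show "(h has_derivative (\<lambda>v. v \<bullet> D)) (at (x + s *\<^sub>R d))"
      using assms by (simp add: gderiv_def)
  qed
  then show ?thesis
    by (simp add: has_field_derivative_def mult.commute[of _ "d \<bullet> D"])
qed

text \<open>The directional derivative is the limit of the one-sided difference quotients, each of
  which is at least \<open>c\<close>. Only steps in (0, 1] are tested, since convexity controls a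
  function only along a segment.\<close>

lemma gderiv_lower_bound:
  fixes h :: "'a::real_inner \<Rightarrow> real"
  assumes "GDERIV h x :> D"
    and "\<And>s. 0 < s \<Longrightarrow> s \<le> 1 \<Longrightarrow> h (x + s *\<^sub>R d) - h x \<ge> s * c"
  shows "c \<le> d \<bullet> D"
proof -
  have "((\<lambda>s. h (x + s *\<^sub>R d)) has_real_derivative d \<bullet> D) (at 0 within {0<..})"
    using assms(1) by (intro gderiv_direction) simp
  then have "((\<lambda>s. (h (x + s *\<^sub>R d) - h x) / s) \<longlongrightarrow> d \<bullet> D) (at_right 0)"
    by (simp add: has_field_derivative_iff)
  moreover have "\<forall>\<^sub>F s in at_right 0. c \<le> (h (x + s *\<^sub>R d) - h x) / s"
    unfolding eventually_at_right_field
    by (intro exI[of _ 1]) (use assms(2) in \<open>auto simp: field_simps\<close>)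
  ultimately show ?thesis
    by (intro tendsto_lowerbound) auto
qed

lemma convex_gradient_ineq:
  fixes h :: "'a::real_inner \<Rightarrow> real"
  assumes "convex_on UNIV h" "GDERIV h x :> D"
  shows "h x + D \<bullet> (z - x) \<le> h z"
proof -
  \<comment> \<open>Convexity bounds the increments of \<open>h\<close> from above, whereas
    \<open>gderiv_lower_bound\<close> wants a bound from below; hence the sign change.\<close>
  have "GDERIV (\<lambda>w. - h w) x :> - D"
    using assms(2) by (rule GDERIV_minus)
  moreover have "- h (x + s *\<^sub>R (z - x)) - - h x \<ge> s * (h x - h z)" if "0 < s" "s \<le> 1" for s
  proof -
    have "x + s *\<^sub>R (z - x) = (1 - s) *\<^sub>R x + s *\<^sub>R z"
      by (simp add: algebra_simps)
    then show ?thesis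
      using convex_onD[OF assms(1), of s x z] that by (simp add: algebra_simps)
  qed
  ultimately have "h x - h z \<le> (z - x) \<bullet> - D"
    by (rule gderiv_lower_bound)
  then show ?thesis
    by (simp add: inner_commute)
qed

lemma descent_lemma:
  fixes h :: "'a::real_inner \<Rightarrow> real"
  assumes "lipschitz_gradient L h"
  shows "h z \<le> h x + grad h x \<bullet> (z - x) + L / 2 * (norm (z - x))\<^sup>2"
proof -
  define d where "d = z - x"
  \<comment> \<open>Up to the constant \<open>h x\<close>, this is \<open>h\<close> minus its
    quadratic model along the segment. The Lipschitz bound on the gradient makes its derivative
    nonpositive, and comparing the endpoints gives the claim.\<close>
  define \<phi> where "\<phi> s = h (x + s *\<^sub>R d) - s * (grad h x \<bullet> d) - L / 2 * s\<^sup>2 * (norm d)\<^sup>2" for s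
  have "\<phi> 1 \<le> \<phi> 0"
  proof (rule DERIV_nonpos_imp_nonincreasing[of 0 1 \<phi>])
    fix s :: real
    assume s: "0 \<le> s" "s \<le> 1"
    have "(\<phi> has_real_derivative d \<bullet> grad h (x + s *\<^sub>R d) - grad h x \<bullet> d - L * s * (norm d)\<^sup>2) (at s)"
      unfolding \<phi>_def using assms
      by (auto intro!: derivative_eq_intros gderiv_direction simp: lipschitz_gradient_def)
    moreover have "d \<bullet> grad h (x + s *\<^sub>R d) - grad h x \<bullet> d - L * s * (norm d)\<^sup>2 \<le> 0"
    proof -
      have "d \<bullet> (grad h (x + s *\<^sub>R d) - grad h x) \<le> norm d * norm (grad h (x + s *\<^sub>R d) - grad h x)"
        by (rule norm_cauchy_schwarz)
      also have "\<dots> \<le> norm d * (L * norm (s *\<^sub>R d))"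
        using assms lipschitz_onD[of L UNIV "grad h" "x + s *\<^sub>R d" x]
        by (intro mult_left_mono) (auto simp: lipschitz_gradient_def dist_norm)
      finally show ?thesis
        using s by (simp add: inner_diff_right inner_commute power2_eq_square algebra_simps)
    qed
    ultimately show "\<exists>y. (\<phi> has_real_derivative y) (at s) \<and> y \<le> 0"
      by blast
  qed simp
  then show ?thesis
    by (simp add: \<phi>_def d_def)
qed

section \<open>Optimality conditions for convex plus differentiable objectives\<close>

lemma argmin_set_finite:
  assumes "w \<in> argmin_set (\<lambda>z. F z + ereal (q z))" "proper_fun F" "\<forall>z. F z \<noteq> -\<infinity>"
  shows "F w = ereal (real_of_ereal (F w))"
proof -
  obtain z where "F z < \<infinity>"
    using assms(2) by (auto simp: proper_fun_def edom_def)
  moreover have "F w + ereal (q w) \<le> F z + ereal (q z)"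
    using assms(1) by (auto simp: argmin_set_def is_arg_min_def not_less)
  ultimately show ?thesis
    using assms(3)[rule_format, of w] by (cases "F w"; cases "F z") auto
qed

text \<open>Moving from \<open>w\<close> a fraction \<open>s\<close> of the way to \<open>z\<close>
  raises \<open>F\<close> by at most \<open>s * (F z - F w)\<close>, so minimality lets
  \<open>q\<close> drop by at most that much. Dividing by \<open>s\<close> and passing to the limit
  gives the subgradient inequality.\<close>

lemma argmin_set_subgradient:
  fixes F :: "'a::real_inner \<Rightarrow> ereal"
  assumes min: "w \<in> argmin_set (\<lambda>z. F z + ereal (q z))"
    and F: "proper_fun F" "\<forall>z. F z \<noteq> -\<infinity>" "convex_fun F"
    and q: "GDERIV q w :> D"
  shows "- D \<in> subdifferential F w"
proof -
  define a where "a = real_of_ereal (F w)"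
  have a: "F w = ereal a"
    unfolding a_def using min F(1,2) by (rule argmin_set_finite)
  have "F w + ereal (- D \<bullet> (z - w)) \<le> F z" for z
  proof (cases "F z")
    case (real c)
    have "q (w + s *\<^sub>R (z - w)) - q w \<ge> s * (a - c)" if s: "0 < s" "s \<le> 1" for s
    proof -
      have "w + s *\<^sub>R (z - w) = (1 - s) *\<^sub>R w + s *\<^sub>R z"
        by (simp add: algebra_simps)
      then have "F (w + s *\<^sub>R (z - w)) \<le> ereal ((1 - s) * a + s * c)"
        using F(3)[unfolded convex_fun_def, rule_format, of "1 - s" s w z] s a real by simp
      moreover have "F w + ereal (q w) \<le> F (w + s *\<^sub>R (z - w)) + ereal (q (w + s *\<^sub>R (z - w)))"
        using min by (auto simp: argmin_set_def is_arg_min_def not_less)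
      ultimately show ?thesis
        using a by (cases "F (w + s *\<^sub>R (z - w))") (auto simp: algebra_simps)
    qed
    with q have "a - c \<le> (z - w) \<bullet> D"
      by (rule gderiv_lower_bound)
    then show ?thesis
      using a real by (simp add: inner_commute)
  qed (use F in auto)
  then show ?thesis
    using a by (simp add: subdifferential_def edom_def)
qed

section \<open>Inequalities for one iteration\<close>

lemma composite_ineq:
  fixes h :: "'a::real_inner \<Rightarrow> real"
  assumes h: "convex_on UNIV h" "lipschitz_gradient L h"
    and sub: "a + \<xi> \<bullet> (z - w) + \<mu> / 2 * (norm (z - w))\<^sup>2 \<le> c"
  shows "a + h w \<le> c + h z - (\<xi> + grad h wb) \<bullet> (z - w) + L / 2 * (norm (w - wb))\<^sup>2
    - \<mu> / 2 * (norm (z - w))\<^sup>2"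
proof -
  \<comment> \<open>Both estimates of \<open>h\<close> are anchored at the point \<open>wb\<close>
    where the gradient is evaluated, so \<open>h wb\<close> cancels when they are combined.\<close>
  have "h wb + grad h wb \<bullet> (z - wb) \<le> h z"
    using h by (intro convex_gradient_ineq) (auto simp: lipschitz_gradient_def)
  moreover have "h w \<le> h wb + grad h wb \<bullet> (w - wb) + L / 2 * (norm (w - wb))\<^sup>2"
    using h(2) by (rule descent_lemma)
  ultimately show ?thesis
    using sub by (simp add: inner_simps)
qed

text \<open>The weights \<open>t\<close> at \<open>zs\<close> and \<open>t * (t - 1)\<close> at
  \<open>zk\<close> are chosen so that the two directions \<open>z - zp\<close> add up to
  \<open>t *\<^sub>R (zs - wp)\<close>. By \<open>step\<close>, the term with \<open>c\<close> then
  becomes an inner product of \<open>wp - w\<close> with \<open>zs - wp\<close>, which splits into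
  three squared distances, and the term with \<open>L\<close> becomes a multiple of the squared norm
  of \<open>wp - w\<close>.\<close>

lemma accelerated_step:
  fixes zk zp zb zs w wp p :: "'a::real_inner"
  assumes t: "t \<ge> 1" and \<mu>: "\<mu> \<ge> 0"
    and wp: "wp = zp + (t - 1) *\<^sub>R (zp - zk)"
    and step: "t *\<^sub>R (zp - zb) = wp - w"
    and ineq: "\<And>z Fz. (z, Fz) \<in> {(zs, Fs), (zk, Fk)} \<Longrightarrow>
      Fp \<le> Fz + (c *\<^sub>R (zp - zb) + (\<mu> * (t - 1)) *\<^sub>R (zp - zk) + p) \<bullet> (z - zp)
        + L / 2 * (norm (zp - zb))\<^sup>2 - \<mu> / 2 * (norm (z - zp))\<^sup>2"
  shows "t\<^sup>2 * Fp - t * (t - 1) * Fk - t * Fs \<le> t * (p \<bullet> (zs - wp))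
    + c / 2 * ((norm (w - zs))\<^sup>2 - (norm (wp - zs))\<^sup>2) - (c - L) / 2 * (norm (wp - w))\<^sup>2
    - \<mu> * t / 2 * (norm (wp - zs))\<^sup>2"
proof -
  define e where "e = zp - zb"
  define d where "d = zp - zk"
  define s where "s = zs - wp"
  let ?q = "c *\<^sub>R e + (\<mu> * (t - 1)) *\<^sub>R d + p"
  have "w = wp - t *\<^sub>R e"
    using step by (simp add: e_def)
  then have vec: "zs - zp = s + (t - 1) *\<^sub>R d" "zk - zp = - d" "wp - w = t *\<^sub>R e"
    "w - zs = - (s + t *\<^sub>R e)" "wp - zs = - s"
    using wp by (simp_all add: d_def s_def)
  have "Fp \<le> Fs + ?q \<bullet> (s + (t - 1) *\<^sub>R d) + L / 2 * (norm e)\<^sup>2 - \<mu> / 2 * (norm (s + (t - 1) *\<^sub>R d))\<^sup>2"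
    using ineq[of zs Fs] by (simp only: vec flip: e_def d_def) simp
  then have 1: "t * Fp \<le> t * (Fs + ?q \<bullet> (s + (t - 1) *\<^sub>R d) + L / 2 * (norm e)\<^sup>2
      - \<mu> / 2 * (norm (s + (t - 1) *\<^sub>R d))\<^sup>2)"
    using t by (intro mult_left_mono) auto
  have "Fp \<le> Fk + ?q \<bullet> (- d) + L / 2 * (norm e)\<^sup>2 - \<mu> / 2 * (norm (- d))\<^sup>2"
    using ineq[of zk Fk] by (simp only: vec flip: e_def d_def) simp
  then have 2: "t * (t - 1) * Fp \<le> t * (t - 1) * (Fk + ?q \<bullet> (- d) + L / 2 * (norm e)\<^sup>2
      - \<mu> / 2 * (norm (- d))\<^sup>2)"
    using t by (intro mult_left_mono) auto
  \<comment> \<open>In the terms with \<open>\<mu>\<close> the products of \<open>d\<close> and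
    \<open>s\<close> cancel. What remains of \<open>d\<close> has the coefficient t (t - 1)^2 + t (t
    - 1) = t^2 (t - 1), and its sign allows dropping it.\<close>
  have 3: "0 \<le> \<mu> * t * (t - 1) * t / 2 * (d \<bullet> d)"
    using t \<mu> by simp
  from 1 2 3 show ?thesis
    unfolding vec power2_norm_eq_inner s_def[symmetric]
    by (simp add: inner_simps inner_commute algebra_simps power2_eq_square diff_divide_distrib)
qed

text \<open>The vector \<open>lp - (\<gamma> * t) *\<^sub>R q\<close> is the multiplier available
  before the second block is updated, and \<open>q\<close> is the resulting change of the residual.
  The right side exceeds the left by \<gamma> t^2 / 2 times the squared norm of
  \<open>q - h\<close>.\<close>

lemma dual_step:
  fixes l lp ls h q :: "'a::real_inner"
  assumes "\<gamma> > 0" "lp = l + (\<gamma> * t) *\<^sub>R h"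
  shows "- t * ((lp - (\<gamma> * t) *\<^sub>R q - ls) \<bullet> h)
    \<le> \<gamma> * t\<^sup>2 / 2 * (norm q)\<^sup>2 + ((norm (l - ls))\<^sup>2 - (norm (lp - ls))\<^sup>2) / (2 * \<gamma>)"
proof -
  have "0 \<le> \<gamma> * t\<^sup>2 / 2 * ((q - h) \<bullet> (q - h))"
    using assms(1) by simp
  moreover have "((norm (l - ls))\<^sup>2 - (norm (lp - ls))\<^sup>2) / (2 * \<gamma>)
      = - t * ((l - ls) \<bullet> h) - \<gamma> * t\<^sup>2 / 2 * (h \<bullet> h)"
    using assms unfolding power2_norm_eq_inner
    by (simp add: inner_simps inner_commute power2_eq_square field_simps)
  ultimately show ?thesis
    unfolding power2_norm_eq_inner assms(2)
    by (simp add: inner_simps inner_commute power2_eq_square algebra_simps)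
qed

text \<open>Each partial sum is a convex combination of the preceding one and of a vector bounded by
  \<open>C\<close>, so all partial sums stay in the ball of radius \<open>C\<close>. Then
  \<open>a k\<close> is a difference of two vectors of that ball.\<close>

lemma averaged_sum_bound:
  fixes a :: "nat \<Rightarrow> 'a::real_normed_vector" and \<beta> :: "nat \<Rightarrow> real"
  assumes "\<And>k. 0 \<le> \<beta> k" "\<And>k. \<beta> k \<le> 1"
    and bound: "\<And>k. norm (a k + (\<Sum>j<k. \<beta> j *\<^sub>R a j)) \<le> C"
  shows "norm (a k) \<le> 2 * C"
proof -
  let ?T = "\<lambda>k. \<Sum>j<k. \<beta> j *\<^sub>R a j"
  have "norm (?T k) \<le> C" for k
  proof (induction k)
    case 0
    then show ?case
      using order_trans[OF norm_ge_zero bound[of 0]] by simp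
  next
    case (Suc k)
    have "?T (Suc k) = (1 - \<beta> k) *\<^sub>R ?T k + \<beta> k *\<^sub>R (a k + ?T k)"
      by (simp add: algebra_simps)
    also have "norm \<dots> \<le> (1 - \<beta> k) * norm (?T k) + \<beta> k * norm (a k + ?T k)"
      using assms(1,2)[of k] by (intro norm_triangle_le) simp
    also have "\<dots> \<le> C"
      using assms(1,2)[of k] Suc bound[of k] by (intro convex_bound_le) auto
    finally show ?case .
  qed
  then have "norm (a k + ?T k) + norm (?T k) \<le> C + C"
    by (intro add_mono bound)
  then show ?thesis
    using norm_triangle_ineq4[of "a k + ?T k" "?T k"] by simp
qed

section \<open>Subgradients at the solutions of the two subproblems\<close>

lemma gderiv_norm_sq:
  "GDERIV (\<lambda>z. (norm (z - a))\<^sup>2) w :> 2 *\<^sub>R (w - a)"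
  unfolding gderiv_def power2_norm_eq_inner
  by (auto intro!: derivative_eq_intros simp: inner_commute)

lemma gderiv_norm_sq_matrix:
  fixes A :: "real^'m^'p"
  shows "GDERIV (\<lambda>z. (norm (A *v (z - a) + r))\<^sup>2) w :> 2 *\<^sub>R (transpose A *v (A *v (w - a) + r))"
proof -
  have "((\<lambda>z. A *v z - A *v a + r) has_derivative (\<lambda>h. A *v h)) (at w)"
    by (auto intro!: derivative_eq_intros bounded_linear_imp_has_derivative)
  then have *: "((\<lambda>z. A *v (z - a) + r) has_derivative (\<lambda>h. A *v h)) (at w)"
    by (simp add: matrix_vector_mult_diff_distrib)
  have "h \<bullet> (transpose A *v d) = (A *v h) \<bullet> d" for h d
    by (metis dot_lmul_matrix inner_commute transpose_matrix_vector)
  then show ?thesis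
    using has_derivative_inner[OF * *] unfolding gderiv_def power2_norm_eq_inner
    by (simp add: inner_commute del: transpose_matrix_vector)
qed

lemma gderiv_cmult:
  assumes "GDERIV h x :> D"
  shows "GDERIV (\<lambda>z. k * h z) x :> k *\<^sub>R D"
  using GDERIV_mult[OF GDERIV_const assms] by simp

text \<open>One factor \<open>t\<close> is moved inside the bracket. With \<open>r\<close> equal to
  A x_k + B v_k - b, the bracket is then A u_{k+1} + B v_k - b, the residual that enters the
  intermediate multiplier.\<close>

lemma augmented_subproblem_subgradient:
  fixes A :: "real^'m^'p"
  assumes "w \<in> argmin_set (\<lambda>z. F z + ereal (c \<bullet> z
      + \<gamma> * t\<^sup>2 / 2 * (norm (A *v (z - a) + (1 / t) *\<^sub>R r))\<^sup>2
      + 1 / (2 * \<alpha>) * (norm (z - zb))\<^sup>2))"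
    and "proper_fun F" "\<forall>z. F z \<noteq> -\<infinity>" "convex_fun F" "t \<noteq> 0"
  shows "- (c + (\<gamma> * t) *\<^sub>R (transpose A *v (t *\<^sub>R (A *v (w - a)) + r)) + (1 / \<alpha>) *\<^sub>R (w - zb))
    \<in> subdifferential F w"
proof (rule argmin_set_subgradient[OF assms(1-4)])
  have "t *\<^sub>R (A *v (w - a)) + r = t *\<^sub>R (A *v (w - a) + (1 / t) *\<^sub>R r)"
    using assms(5) by (simp add: scaleR_add_right)
  then have eq: "c + (\<gamma> * t) *\<^sub>R (transpose A *v (t *\<^sub>R (A *v (w - a)) + r)) + (1 / \<alpha>) *\<^sub>R (w - zb)
      = c + (\<gamma> * t\<^sup>2 / 2) *\<^sub>R (2 *\<^sub>R (transpose A *v (A *v (w - a) + (1 / t) *\<^sub>R r)))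
        + (1 / (2 * \<alpha>)) *\<^sub>R (2 *\<^sub>R (w - zb))"
    by (simp only: matrix_vector_mult_scaleR scaleR_scaleR) (simp add: power2_eq_square)
  have "GDERIV (\<lambda>z. c \<bullet> z) w :> c"
    unfolding gderiv_def by (auto intro!: derivative_eq_intros simp: inner_commute)
  then show "GDERIV (\<lambda>z. c \<bullet> z + \<gamma> * t\<^sup>2 / 2 * (norm (A *v (z - a) + (1 / t) *\<^sub>R r))\<^sup>2
      + 1 / (2 * \<alpha>) * (norm (z - zb))\<^sup>2) w
      :> c + (\<gamma> * t) *\<^sub>R (transpose A *v (t *\<^sub>R (A *v (w - a)) + r)) + (1 / \<alpha>) *\<^sub>R (w - zb)"
    unfolding eq
    by (intro GDERIV_add gderiv_cmult gderiv_norm_sq gderiv_norm_sq_matrix)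
qed

lemma prox_subgradient:
  assumes "w \<in> prox \<eta> F (zb - \<eta> *\<^sub>R q)"
    and "proper_fun F" "\<forall>z. F z \<noteq> -\<infinity>" "convex_fun F" "\<eta> \<noteq> 0"
  shows "- (q + (1 / \<eta>) *\<^sub>R (w - zb)) \<in> subdifferential F w"
proof -
  have "(1 / (2 * \<eta>)) *\<^sub>R (2 *\<^sub>R (w - (zb - \<eta> *\<^sub>R q))) = q + (1 / \<eta>) *\<^sub>R (w - zb)"
    using assms(5) by (simp add: algebra_simps)
  then have "GDERIV (\<lambda>z. 1 / (2 * \<eta>) * (norm (z - (zb - \<eta> *\<^sub>R q)))\<^sup>2) w
      :> q + (1 / \<eta>) *\<^sub>R (w - zb)"
    using gderiv_cmult[OF gderiv_norm_sq, of "1 / (2 * \<eta>)"] by metis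
  from argmin_set_subgradient[OF assms(1)[unfolded prox_def] assms(2-4) this]
  show ?thesis .
qed

section \<open>Saddle points and the combined primal-dual estimates\<close>

lemma saddle_point_finite_feasible:
  fixes A :: "real^'m^'p"
  assumes saddle: "(xs, ys, ls) \<in> saddle_points (lagrangian f g A B b)"
    and "\<forall>z. f z \<noteq> -\<infinity>" "\<forall>z. g z \<noteq> -\<infinity>" "x0 \<in> edom f" "y0 \<in> edom g"
  shows "\<bar>f xs\<bar> \<noteq> \<infinity>" "\<bar>g ys\<bar> \<noteq> \<infinity>" "A *v xs + B *v ys = b"
proof -
  have min: "lagrangian f g A B b xs ys ls \<le> lagrangian f g A B b x0 y0 ls"
    and max: "lagrangian f g A B b xs ys l \<le> lagrangian f g A B b xs ys ls" for l
    using saddle by (auto simp: saddle_points_def)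
  have "f xs + g ys \<noteq> \<infinity>"
    using min assms(4,5) by (auto simp: lagrangian_def edom_def)
  then show fin: "\<bar>f xs\<bar> \<noteq> \<infinity>" "\<bar>g ys\<bar> \<noteq> \<infinity>"
    using assms(2)[rule_format, of xs] assms(3)[rule_format, of ys] by auto
  let ?r = "A *v xs + B *v ys - b"
  \<comment> \<open>Shifting the multiplier by the residual itself would raise the Lagrangian by the
    squared norm of the residual.\<close>
  have "(ls + ?r) \<bullet> ?r \<le> ls \<bullet> ?r"
    using max[of "ls + ?r"] fin by (cases "f xs"; cases "g ys") (auto simp: lagrangian_def)
  then have "?r \<bullet> ?r \<le> 0"
    by (simp add: inner_add_left)
  then have "?r = 0"
    by (metis inner_eq_zero_iff inner_ge_zero order_antisym)
  then show "A *v xs + B *v ys = b"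
    by simp
qed

text \<open>The sum of both block inequalities and \<open>dual_step\<close>; \<open>a\<close> and
  \<open>c\<close> stand for 1 / \<alpha> and t^2 / \<beta>. Since \<open>lb\<close> still contains
  \<open>v\<close> in place of \<open>vp\<close>, a term in \<open>B *v (vp - v)\<close> appears;
  \<open>step_size\<close> lets the negative term of \<open>y_step\<close> absorb it.\<close>

lemma primal_dual_step:
  fixes A :: "real^'m^'p" and B :: "real^'n^'p"
  assumes "\<gamma> > 0"
    and x_step: "t\<^sup>2 * Fp - t * (t - 1) * Fk - t * Fs \<le> t * ((transpose A *v lb) \<bullet> (xs - up))
      + a / 2 * ((norm (u - xs))\<^sup>2 - (norm (up - xs))\<^sup>2)"
    and y_step: "t\<^sup>2 * Gp - t * (t - 1) * Gk - t * Gs \<le> t * ((transpose B *v lb) \<bullet> (ys - vp))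
      + c / 2 * ((norm (v - ys))\<^sup>2 - (norm (vp - ys))\<^sup>2) - (c - L) / 2 * (norm (vp - v))\<^sup>2
      - \<mu> * t / 2 * (norm (vp - ys))\<^sup>2"
    and up: "up = xp + (t - 1) *\<^sub>R (xp - xk)" and vp: "vp = yp + (t - 1) *\<^sub>R (yp - yk)"
    and lb: "lb = l + (\<gamma> * t) *\<^sub>R (A *v up + B *v v - b)"
    and lp: "lp = l + (\<gamma> * t) *\<^sub>R (A *v up + B *v vp - b)"
    and feas: "A *v xs + B *v ys = b"
    and step_size: "\<gamma> * t\<^sup>2 * (onorm (\<lambda>z. B *v z))\<^sup>2 \<le> c - L"
  shows "t\<^sup>2 * (Fp + Gp + ls \<bullet> (A *v xp + B *v yp - b) - Fs - Gs)
      + a / 2 * (norm (up - xs))\<^sup>2 + (c + \<mu> * t) / 2 * (norm (vp - ys))\<^sup>2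
      + 1 / (2 * \<gamma>) * (norm (lp - ls))\<^sup>2
    \<le> (t\<^sup>2 - t) * (Fk + Gk + ls \<bullet> (A *v xk + B *v yk - b) - Fs - Gs)
      + a / 2 * (norm (u - xs))\<^sup>2 + c / 2 * (norm (v - ys))\<^sup>2
      + 1 / (2 * \<gamma>) * (norm (l - ls))\<^sup>2"
proof -
  define h where "h = A *v up + B *v vp - b"
  define q where "q = B *v (vp - v)"
  have lb': "lb = lp - (\<gamma> * t) *\<^sub>R q"
    unfolding lb lp q_def by (simp add: algebra_simps)
  have "norm q \<le> onorm (\<lambda>z. B *v z) * norm (vp - v)"
    unfolding q_def by (intro onorm) simp
  then have "(norm q)\<^sup>2 \<le> (onorm (\<lambda>z. B *v z))\<^sup>2 * (norm (vp - v))\<^sup>2"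
    by (metis norm_ge_zero power_mono power_mult_distrib)
  then have "\<gamma> * t\<^sup>2 * (norm q)\<^sup>2 \<le> \<gamma> * t\<^sup>2 * ((onorm (\<lambda>z. B *v z))\<^sup>2 * (norm (vp - v))\<^sup>2)"
    using \<open>\<gamma> > 0\<close> by (intro mult_left_mono) auto
  also have "\<dots> \<le> (c - L) * (norm (vp - v))\<^sup>2"
    using mult_right_mono[OF step_size, of "(norm (vp - v))\<^sup>2"] by (simp add: mult.assoc)
  finally have 1: "\<gamma> * t\<^sup>2 / 2 * (norm q)\<^sup>2 \<le> (c - L) / 2 * (norm (vp - v))\<^sup>2"
    by simp
  have 2: "- t * ((lb - ls) \<bullet> h)
      \<le> \<gamma> * t\<^sup>2 / 2 * (norm q)\<^sup>2 + ((norm (l - ls))\<^sup>2 - (norm (lp - ls))\<^sup>2) / (2 * \<gamma>)"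
    unfolding lb' using \<open>\<gamma> > 0\<close> lp by (intro dual_step) (simp_all add: h_def)
  have "(transpose A *v lb) \<bullet> (xs - up) + (transpose B *v lb) \<bullet> (ys - vp)
      = lb \<bullet> (A *v (xs - up) + B *v (ys - vp))"
    by (simp add: dot_lmul_matrix inner_add_right)
  also have "A *v (xs - up) + B *v (ys - vp) = - h"
    unfolding h_def using feas by (simp add: matrix_vector_mult_diff_distrib algebra_simps)
  finally have 3: "t * ((transpose A *v lb) \<bullet> (xs - up)) + t * ((transpose B *v lb) \<bullet> (ys - vp))
      = - t * (lb \<bullet> h)"
    by (simp flip: distrib_left)
  \<comment> \<open>After multiplication by \<open>t\<close>, the residuals at the new and the old
    iterate carry the weights t^2 and t^2 - t, the same as the objective values, so they complete
    these to values of the Lagrangian.\<close>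
  have "h = t *\<^sub>R (A *v xp + B *v yp - b) - (t - 1) *\<^sub>R (A *v xk + B *v yk - b)"
    unfolding h_def up vp
    by (simp add: algebra_simps matrix_vector_mult_scaleR)
  then have "t * (ls \<bullet> h) = t\<^sup>2 * (ls \<bullet> (A *v xp + B *v yp - b))
      - (t\<^sup>2 - t) * (ls \<bullet> (A *v xk + B *v yk - b))"
    by (simp only: inner_diff_right inner_scaleR_right) (simp add: algebra_simps power2_eq_square)
  with 1 2 3 x_step y_step show ?thesis
    by (simp add: inner_diff_left algebra_simps add_divide_distrib diff_divide_distrib power2_eq_square)
qed

text \<open>Summing \<open>l_step\<close> expresses the bounded difference \<open>l k - l 1\<close>
  through the scaled residuals in the form required by \<open>averaged_sum_bound\<close>.\<close>

lemma multiplier_residual_bound: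
  fixes r l :: "nat \<Rightarrow> 'a::real_normed_vector" and t :: "nat \<Rightarrow> real"
  assumes "\<gamma> > 0"
    and t_ge: "\<And>k. k \<ge> 1 \<Longrightarrow> t k \<ge> 1"
    and t_step: "\<And>k. k \<ge> 1 \<Longrightarrow> (t (Suc k))\<^sup>2 \<le> (t k)\<^sup>2 + t (Suc k)"
    and l_step: "\<And>k. k \<ge> 1 \<Longrightarrow> l (Suc k) - l k
      = \<gamma> *\<^sub>R ((t (Suc k))\<^sup>2 *\<^sub>R r (Suc k) - ((t (Suc k))\<^sup>2 - t (Suc k)) *\<^sub>R r k)"
    and bounded: "\<And>k. k \<ge> 1 \<Longrightarrow> norm (l k - l 1) \<le> M"
    and k: "k \<ge> 1"
  shows "(t k)\<^sup>2 * norm (r k) \<le> 2 * ((t 1)\<^sup>2 * norm (r 1) + M / \<gamma>)"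
proof -
  define a where "a j = (t (Suc j))\<^sup>2 *\<^sub>R r (Suc j)" for j
  \<comment> \<open>Here 1 - \<open>\<beta> j\<close> is the quotient of t_{j+2}^2 - t_{j+2} by
    t_{j+1}^2, so \<open>l_step\<close> says that
    \<open>a (Suc j) - (1 - \<beta> j) *\<^sub>R a j\<close> is the multiplier increment divided by
    \<gamma>. The growth condition \<open>t_step\<close> yields nonnegativity, and t \<ge> 1 the
    upper bound 1.\<close>
  define \<beta> where
    "\<beta> j = ((t (Suc j))\<^sup>2 - (t (Suc (Suc j)))\<^sup>2 + t (Suc (Suc j))) / (t (Suc j))\<^sup>2" for j
  have t_pos: "(t (Suc j))\<^sup>2 > 0" for j
    using t_ge[of "Suc j"] by (intro zero_less_power) simp
  have sum: "a k + (\<Sum>j<k. \<beta> j *\<^sub>R a j) = a 0 + (1 / \<gamma>) *\<^sub>R (l (Suc k) - l 1)" for k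
  proof (induction k)
    case (Suc k)
    have "\<beta> k *\<^sub>R a k
        = ((t (Suc k))\<^sup>2 - (t (Suc (Suc k)))\<^sup>2 + t (Suc (Suc k))) *\<^sub>R r (Suc k)"
      using t_pos[of k] by (simp add: a_def \<beta>_def)
    then have "a (Suc k) - a k + \<beta> k *\<^sub>R a k = (1 / \<gamma>) *\<^sub>R (l (Suc (Suc k)) - l (Suc k))"
      unfolding l_step[of "Suc k", simplified]
      using \<open>\<gamma> > 0\<close> by (simp add: a_def algebra_simps)
    then have "a (Suc k) + \<beta> k *\<^sub>R a k = a k + (1 / \<gamma>) *\<^sub>R (l (Suc (Suc k)) - l (Suc k))"
      by (simp add: algebra_simps)
    then have "a (Suc k) + (\<Sum>j<Suc k. \<beta> j *\<^sub>R a j)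
        = (a k + (\<Sum>j<k. \<beta> j *\<^sub>R a j)) + (1 / \<gamma>) *\<^sub>R (l (Suc (Suc k)) - l (Suc k))"
      by simp
    also have "\<dots> = a 0 + (1 / \<gamma>) *\<^sub>R (l (Suc (Suc k)) - l 1)"
      unfolding Suc by (simp add: scaleR_diff_right)
    finally show ?case .
  qed simp
  \<comment> \<open>The index of \<open>a\<close> starts at 0 and that of \<open>r\<close> at
    1.\<close>
  have "norm (a (k - 1)) \<le> 2 * (norm (a 0) + M / \<gamma>)"
  proof (rule averaged_sum_bound)
    fix j
    show "0 \<le> \<beta> j"
      using t_step[of "Suc j"] t_pos[of j] by (simp add: \<beta>_def)
    have "t (Suc (Suc j)) \<le> (t (Suc (Suc j)))\<^sup>2"
      using t_ge[of "Suc (Suc j)"] by (intro self_le_power) auto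
    then show "\<beta> j \<le> 1"
      using t_pos[of j] by (simp add: \<beta>_def)
    have "norm (a 0 + (1 / \<gamma>) *\<^sub>R (l (Suc j) - l 1))
        \<le> norm (a 0) + norm ((1 / \<gamma>) *\<^sub>R (l (Suc j) - l 1))"
      by (rule norm_triangle_ineq)
    also have "\<dots> \<le> norm (a 0) + M / \<gamma>"
      using bounded[of "Suc j"] \<open>\<gamma> > 0\<close> by (simp add: divide_right_mono)
    finally show "norm (a j + (\<Sum>i<j. \<beta> i *\<^sub>R a i)) \<le> norm (a 0) + M / \<gamma>"
      by (simp only: sum)
  qed
  then show ?thesis
    using k by (simp add: a_def)
qed

text \<open>The extrapolation factor is exactly what makes the scaled step a difference of
  consecutive momentum points, as the hypothesis \<open>step\<close> of
  \<open>accelerated_step\<close> demands.\<close>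

lemma momentum_step:
  fixes z zp d :: "'a::real_vector"
  assumes "t \<noteq> 0"
  shows "t *\<^sub>R (zp - (z + ((s - 1) / t) *\<^sub>R d))
    = zp + (t - 1) *\<^sub>R (zp - z) - (z + (s - 1) *\<^sub>R d)"
proof -
  have "t *\<^sub>R (((s - 1) / t) *\<^sub>R d) = (s - 1) *\<^sub>R d"
    using assms by simp
  then show ?thesis
    by (simp only: scaleR_diff_right scaleR_add_right scaleR_diff_left scaleR_one) simp
qed

theorem theorem2:
  fixes f f1 :: "real^'m \<Rightarrow> ereal" and f2 :: "real^'m \<Rightarrow> real"
    and g g1 :: "real^'n \<Rightarrow> ereal" and g2 :: "real^'n \<Rightarrow> real"
    and A :: "real^'m^'p" and B :: "real^'n^'p" and b :: "real^'p"
    and \<mu>g Lf2 Lg2 \<alpha> \<beta> \<gamma> E1 C2 :: real and t :: "nat \<Rightarrow> real"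
    and x u :: "nat \<Rightarrow> real^'m" and y v :: "nat \<Rightarrow> real^'n" and l :: "nat \<Rightarrow> real^'p"
    and xs :: "real^'m" and ys :: "real^'n" and ls :: "real^'p"
    and \<L> :: "real^'m \<Rightarrow> real^'n \<Rightarrow> real^'p \<Rightarrow> ereal"
  assumes f_eq: "f = (\<lambda>z. f1 z + ereal (f2 z))"
    and g_eq: "g = (\<lambda>z. g1 z + ereal (g2 z))"
    and f1: "\<forall>z. f1 z \<noteq> -\<infinity>" "proper_fun f1" "closed_fun f1" "convex_fun f1"
    and f2: "convex_on UNIV f2" "lipschitz_gradient Lf2 f2"
    and g1: "\<forall>z. g1 z \<noteq> -\<infinity>" "proper_fun g1" "closed_fun g1"
      "\<mu>g > 0" "strongly_convex_fun \<mu>g g1"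
    and g2: "convex_on UNIV g2" "lipschitz_gradient Lg2 g2"
    and L_eq: "\<L> = lagrangian f g A B b"
    and saddle: "(xs, ys, ls) \<in> saddle_points \<L>"
    and params: "\<alpha> > 0" "\<beta> > 0" "\<gamma> > 0"
    and alg: "generated_by_algorithm f1 f2 g1 g2 A B b \<mu>g \<alpha> \<beta> \<gamma> t x y u v l"
    and alpha_le: "ereal \<alpha> \<le> 1 / ereal Lf2"
    and beta_le: "ereal \<beta> \<le>
      ereal ((t 1)\<^sup>2) / ereal (Lg2 + (t 1)\<^sup>2 * \<gamma> * (onorm (\<lambda>z. B *v z))\<^sup>2)"
    and t_ge: "\<forall>k\<ge>1. t k \<ge> 1"
    and t_mono: "\<forall>k\<ge>1. t k \<le> t (k+1)"
    and t_step1: "\<forall>k\<ge>1. (t (k+1))\<^sup>2 \<le> (t k)\<^sup>2 + t (k+1)"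
    and t_step2: "\<forall>k\<ge>1. (t (k+1))\<^sup>2 \<le> (t k)\<^sup>2 + \<beta> * \<mu>g * t k"
    and E1_eq: "E1 = (t 1)\<^sup>2 * real_of_ereal (\<L> (x 1) (y 1) ls - \<L> xs ys ls)
      + 1 / (2 * \<alpha>) * (norm (x 1 - xs))\<^sup>2
      + (t 2)\<^sup>2 / (2 * \<beta>) * (norm (y 1 - ys))\<^sup>2
      + 1 / (2 * \<gamma>) * (norm (l 1 - ls))\<^sup>2"
    and C2_eq: "C2 = 3 * (t 1)\<^sup>2 * norm (A *v x 1 + B *v y 1 - b)
      + (2 * norm (l 1 - ls) + 2 * sqrt (2 * \<gamma> * E1)) / \<gamma>"
  shows "\<forall>k\<ge>1.
      \<L> (x k) (y k) ls - \<L> xs ys ls \<le> ereal (E1 / (t k)\<^sup>2) \<and>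
      norm (A *v x k + B *v y k - b) \<le> C2 / (t k)\<^sup>2 \<and>
      \<bar>f (x k) + g (y k) - f xs - g ys\<bar> \<le> ereal ((E1 + C2 * norm ls) / (t k)\<^sup>2)"
proof -

  \<comment> \<open>Step-size conditions as inequalities between reals\<close>
  have g1_convex: "convex_fun g1"
    using g1(5) by (simp add: strongly_convex_fun_def)
  have Lf2: "Lf2 \<ge> 0" and Lg2: "Lg2 \<ge> 0"
    using f2(2) g2(2) lipschitz_on_nonneg by (auto simp: lipschitz_gradient_def)
  \<comment> \<open>A zero denominator makes the bound in \<open>ereal\<close> infinite and thus
    uninformative. Here, and for \<open>\<beta>_Lg2\<close> below, the inequality wanted is then
    trivial.\<close>
  have \<alpha>_Lf2: "Lf2 \<le> 1 / \<alpha>"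
  proof (cases "Lf2 = 0")
    case False
    then have "\<alpha> \<le> 1 / Lf2"
      using alpha_le Lf2 by (simp add: one_ereal_def)
    then show ?thesis
      using False Lf2 params(1) by (simp add: field_simps)
  qed (use params in simp)
  define N where "N = onorm (\<lambda>z. B *v z)"
  have \<beta>_Lg2: "\<beta> * (Lg2 + (t 1)\<^sup>2 * \<gamma> * N\<^sup>2) \<le> (t 1)\<^sup>2"
  proof (cases "Lg2 + (t 1)\<^sup>2 * \<gamma> * N\<^sup>2 = 0")
    case False
    then have pos: "Lg2 + (t 1)\<^sup>2 * \<gamma> * N\<^sup>2 > 0"
      using Lg2 params(3) by (smt (verit) mult_nonneg_nonneg zero_le_power2)
    have "\<beta> \<le> (t 1)\<^sup>2 / (Lg2 + (t 1)\<^sup>2 * \<gamma> * N\<^sup>2)"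
      using beta_le False by (simp flip: N_def)
    then show ?thesis
      using pos by (simp add: pos_le_divide_eq)
  qed simp
  have t_ge1: "t k \<ge> t 1" if "k \<ge> 1" for k
    using that
  proof (induction k rule: dec_induct)
    case (step k)
    then show ?case
      using t_mono by (metis Suc_eq_plus1 order_trans)
  qed simp
  \<comment> \<open>The hypothesis concerns \<open>t 1\<close> only. It carries over to later
    \<open>k\<close> because (t k)^2 (1 - \<beta> \<gamma> N^2) grows with \<open>t k\<close>, the
    bracket being nonnegative.\<close>
  have step_size: "\<gamma> * (t k)\<^sup>2 * N\<^sup>2 \<le> (t k)\<^sup>2 / \<beta> - Lg2" if "k \<ge> 1" for k
  proof -
    have "(t 1)\<^sup>2 > 0"
      using t_ge by (intro zero_less_power) (metis less_le_trans order_refl zero_less_one)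
    have "0 \<le> \<beta> * Lg2"
      using Lg2 params(2) by simp
    then have "(t 1)\<^sup>2 * (\<beta> * \<gamma> * N\<^sup>2) \<le> (t 1)\<^sup>2 * 1"
      using \<beta>_Lg2 by (simp add: algebra_simps)
    then have "\<beta> * \<gamma> * N\<^sup>2 \<le> 1"
      using \<open>(t 1)\<^sup>2 > 0\<close> by simp
    moreover have "(t 1)\<^sup>2 \<le> (t k)\<^sup>2"
      using t_ge1[OF that] t_ge by (intro power_mono) (auto intro: order_trans[OF zero_le_one])
    ultimately have "(t 1)\<^sup>2 * (1 - \<beta> * \<gamma> * N\<^sup>2) \<le> (t k)\<^sup>2 * (1 - \<beta> * \<gamma> * N\<^sup>2)"
      by (intro mult_right_mono) auto
    then have "\<beta> * Lg2 \<le> (t k)\<^sup>2 * (1 - \<beta> * \<gamma> * N\<^sup>2)"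
      using \<beta>_Lg2 by (simp add: algebra_simps)
    then show ?thesis
      using params(2) by (simp add: field_simps)
  qed

  \<comment> \<open>The iterates and their extrapolations\<close>
  define xb where "xb k = x k + ((t k - 1) / t (Suc k)) *\<^sub>R (x k - x (k-1))" for k
  define yb where "yb k = y k + ((t k - 1) / t (Suc k)) *\<^sub>R (y k - y (k-1))" for k
  define lb where "lb k = l k + (\<gamma> * t (Suc k)) *\<^sub>R (A *v u (Suc k) + B *v v k - b)" for k
  define \<eta> where "\<eta> k = \<beta> / ((t (Suc k))\<^sup>2 + \<beta> * \<mu>g * (t (Suc k) - 1))" for k
  have x_init: "x 1 = x 0" "u 1 = x 1" "f (x 1) < \<infinity>" and y_init: "y 1 = y 0" "v 1 = y 1" "g (y 1) < \<infinity>"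
    using alg by (auto simp: generated_by_algorithm_def f_eq g_eq edom_def)
  have x_min: "x (Suc k) \<in> argmin_set (\<lambda>z. f1 z + ereal ((transpose A *v l k + grad f2 (xb k)) \<bullet> z
        + \<gamma> * (t (Suc k))\<^sup>2 / 2 *
            (norm (A *v (z - x k) + (1 / t (Suc k)) *\<^sub>R (A *v x k + B *v v k - b)))\<^sup>2
        + 1 / (2 * \<alpha>) * (norm (z - xb k))\<^sup>2))"
    and u_step: "u (Suc k) = x (Suc k) + (t (Suc k) - 1) *\<^sub>R (x (Suc k) - x k)"
    and y_prox: "y (Suc k) \<in> prox (\<eta> k) g1 (yb k - \<eta> k *\<^sub>R
        ((\<mu>g * (t (Suc k) - 1)) *\<^sub>R (yb k - y k) + transpose B *v lb k + grad g2 (yb k)))"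
    and v_step: "v (Suc k) = y (Suc k) + (t (Suc k) - 1) *\<^sub>R (y (Suc k) - y k)"
    and l_step: "l (Suc k) = l k + (\<gamma> * t (Suc k)) *\<^sub>R (A *v u (Suc k) + B *v v (Suc k) - b)"
    if "k \<ge> 1" for k
    using alg that
    unfolding generated_by_algorithm_def Let_def xb_def yb_def lb_def \<eta>_def Suc_eq_plus1
    by blast+
  have tk: "t k \<ge> 1" "t (Suc k) \<ge> 1" if "k \<ge> 1" for k
    using t_ge that by auto
  \<comment> \<open>The initialisation \<open>x 1 = x 0\<close> makes the formula valid at
    \<open>k = 1\<close> too, so the first iteration is treated like all others.\<close>
  have u_eq: "u k = x k + (t k - 1) *\<^sub>R (x k - x (k-1))" if "k \<ge> 1" for k
    using that u_step x_init by (cases k; cases "k = 1") auto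
  have v_eq: "v k = y k + (t k - 1) *\<^sub>R (y k - y (k-1))" if "k \<ge> 1" for k
    using that v_step y_init by (cases k; cases "k = 1") auto
  have u_diff: "t (Suc k) *\<^sub>R (x (Suc k) - xb k) = u (Suc k) - u k" if "k \<ge> 1" for k
    using tk(2)[OF that] unfolding u_step[OF that] u_eq[OF that] xb_def
    by (intro momentum_step) simp
  have v_diff: "t (Suc k) *\<^sub>R (y (Suc k) - yb k) = v (Suc k) - v k" if "k \<ge> 1" for k
    using tk(2)[OF that] unfolding v_step[OF that] v_eq[OF that] yb_def
    by (intro momentum_step) simp

  \<comment> \<open>Finiteness of the objective values\<close>
  define f1r where "f1r z = real_of_ereal (f1 z)" for z
  define g1r where "g1r z = real_of_ereal (g1 z)" for z
  have f1x: "f1 (x k) = ereal (f1r (x k))" if k: "k \<ge> 1" for k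
  proof (cases "k = 1")
    case True
    then show ?thesis
      using x_init(3) f1(1)[rule_format, of "x 1"]
      by (cases "f1 (x 1)") (auto simp: f_eq f1r_def)
  next
    case False
    then obtain j where "k = Suc j" "j \<ge> 1"
      using k by (cases k) auto
    then show ?thesis
      unfolding f1r_def using argmin_set_finite[OF x_min f1(2,1)] by blast
  qed
  have g1y: "g1 (y k) = ereal (g1r (y k))" if k: "k \<ge> 1" for k
  proof (cases "k = 1")
    case True
    then show ?thesis
      using y_init(3) g1(1)[rule_format, of "y 1"]
      by (cases "g1 (y 1)") (auto simp: g_eq g1r_def)
  next
    case False
    then obtain j where "k = Suc j" "j \<ge> 1"
      using k by (cases k) auto
    then show ?thesis
      unfolding g1r_def using argmin_set_finite[OF y_prox[unfolded prox_def] g1(2,1)] by blast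
  qed
  have "\<forall>z. f z \<noteq> -\<infinity>" "\<forall>z. g z \<noteq> -\<infinity>"
    using f1(1) g1(1) by (simp_all add: f_eq g_eq)
  note saddle_facts = saddle_point_finite_feasible[OF saddle[unfolded L_eq] this, of "x 1" "y 1"]
  have f1s: "f1 xs = ereal (f1r xs)" and g1s: "g1 ys = ereal (g1r ys)"
    and feas: "A *v xs + B *v ys = b"
    using saddle_facts x_init(3) y_init(3) unfolding edom_def f_eq g_eq f1r_def g1r_def
    by (cases "f1 xs"; cases "g1 ys"; simp)+

  \<comment> \<open>The Lagrangian gap and the descent inequalities of both blocks\<close>
  define \<phi> where "\<phi> z = f1r z + f2 z" for z
  define \<psi> where "\<psi> z = g1r z + g2 z" for z
  define r where "r k = A *v x k + B *v y k - b" for k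
  define \<Delta> where "\<Delta> k = \<phi> (x k) + \<psi> (y k) + ls \<bullet> r k - \<phi> xs - \<psi> ys" for k
  have L_gap: "\<L> (x k) (y k) ls - \<L> xs ys ls = ereal (\<Delta> k)" if "k \<ge> 1" for k
    unfolding L_eq lagrangian_def f_eq g_eq f1x[OF that] g1y[OF that] f1s g1s feas \<Delta>_def \<phi>_def \<psi>_def r_def
    by simp
  have \<Delta>_nonneg: "\<Delta> k \<ge> 0" if "k \<ge> 1" for k
  proof -
    have "\<L> xs ys ls \<le> \<L> (x k) (y k) ls"
      using saddle by (simp add: saddle_points_def)
    then show ?thesis
      unfolding L_eq lagrangian_def f_eq g_eq f1x[OF that] g1y[OF that] f1s g1s feas
      by (simp add: \<Delta>_def \<phi>_def \<psi>_def r_def)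
  qed

  \<comment> \<open>The vanishing terms are written out so that the inequality has the shape of
    \<open>accelerated_step\<close> with modulus 0.\<close>
  have f_ineq: "\<phi> (x (Suc k)) \<le> Fz + ((1 / \<alpha>) *\<^sub>R (x (Suc k) - xb k)
        + (0 * (t (Suc k) - 1)) *\<^sub>R (x (Suc k) - x k) + transpose A *v lb k) \<bullet> (z - x (Suc k))
      + Lf2 / 2 * (norm (x (Suc k) - xb k))\<^sup>2 - 0 / 2 * (norm (z - x (Suc k)))\<^sup>2"
    if "k \<ge> 1" "(z, Fz) \<in> {(xs, \<phi> xs), (x k, \<phi> (x k))}" for k z Fz
  proof -
    define \<xi> where "\<xi> = - (transpose A *v l k + grad f2 (xb k)
      + (\<gamma> * t (Suc k)) *\<^sub>R (transpose A *v
          (t (Suc k) *\<^sub>R (A *v (x (Suc k) - x k)) + (A *v x k + B *v v k - b)))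
      + (1 / \<alpha>) *\<^sub>R (x (Suc k) - xb k))"
    have "A *v u (Suc k) = t (Suc k) *\<^sub>R (A *v (x (Suc k) - x k)) + A *v x k"
      unfolding u_step[OF that(1)] by (simp add: algebra_simps matrix_vector_mult_scaleR)
    then have lb: "lb k = l k + (\<gamma> * t (Suc k)) *\<^sub>R
        (t (Suc k) *\<^sub>R (A *v (x (Suc k) - x k)) + (A *v x k + B *v v k - b))"
      by (simp add: lb_def)
    have \<xi>: "\<xi> + grad f2 (xb k) = - ((1 / \<alpha>) *\<^sub>R (x (Suc k) - xb k) + transpose A *v lb k)"
      unfolding lb \<xi>_def by (simp only: matrix_vector_right_distrib matrix_vector_mult_scaleR) simp
    have "\<xi> \<in> subdifferential f1 (x (Suc k))"
      unfolding \<xi>_def using x_min[OF that(1)] f1 tk(2)[OF that(1)]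
      by (intro augmented_subproblem_subgradient) auto
    then have "f1 (x (Suc k)) + ereal (\<xi> \<bullet> (z - x (Suc k))) \<le> f1 z"
      by (simp add: subdifferential_def)
    moreover have "f1 z = ereal (f1r z)" "Fz = f1r z + f2 z"
      using that f1s f1x by (auto simp: \<phi>_def)
    ultimately show ?thesis
      using composite_ineq[OF f2, of "f1r (x (Suc k))" \<xi> z "x (Suc k)" 0 "f1r z" "xb k"]
        f1x[of "Suc k"]
      by (simp add: \<xi> \<phi>_def inner_add_left inner_diff_left del: transpose_matrix_vector)
  qed

  have g_ineq: "\<psi> (y (Suc k)) \<le> Gz + (((t (Suc k))\<^sup>2 / \<beta>) *\<^sub>R (y (Suc k) - yb k)
        + (\<mu>g * (t (Suc k) - 1)) *\<^sub>R (y (Suc k) - y k) + transpose B *v lb k) \<bullet> (z - y (Suc k))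
      + Lg2 / 2 * (norm (y (Suc k) - yb k))\<^sup>2 - \<mu>g / 2 * (norm (z - y (Suc k)))\<^sup>2"
    if "k \<ge> 1" "(z, Gz) \<in> {(ys, \<psi> ys), (y k, \<psi> (y k))}" for k z Gz
  proof -
    define \<xi> where "\<xi> = - ((\<mu>g * (t (Suc k) - 1)) *\<^sub>R (yb k - y k) + transpose B *v lb k
      + grad g2 (yb k) + (1 / \<eta> k) *\<^sub>R (y (Suc k) - yb k))"
    have "(t (Suc k))\<^sup>2 + \<beta> * \<mu>g * (t (Suc k) - 1) > 0"
      using tk(2)[OF that(1)] params(2) g1(4) by (intro add_pos_nonneg zero_less_power) auto
    \<comment> \<open>The second summand of \<open>1 / \<eta> k\<close> merges with the explicit
      term in \<open>yb k - y k\<close> into a multiple of \<open>y (Suc k) - y k\<close>, which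
      leaves the coefficient t^2 / \<beta> on \<open>y (Suc k) - yb k\<close>.\<close>
    then have \<eta>: "\<eta> k \<noteq> 0" "1 / \<eta> k = (t (Suc k))\<^sup>2 / \<beta> + \<mu>g * (t (Suc k) - 1)"
      using params(2) by (auto simp: \<eta>_def field_simps)
    have \<xi>: "\<xi> + grad g2 (yb k) = - (((t (Suc k))\<^sup>2 / \<beta>) *\<^sub>R (y (Suc k) - yb k)
        + (\<mu>g * (t (Suc k) - 1)) *\<^sub>R (y (Suc k) - y k) + transpose B *v lb k)"
      unfolding \<xi>_def \<eta>(2)
      by (simp add: scaleR_add_left scaleR_diff_right del: transpose_matrix_vector)
    have "\<xi> \<in> subdifferential g1 (y (Suc k))"
      unfolding \<xi>_def using y_prox[OF that(1)] g1 g1_convex \<eta>(1)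
      by (intro prox_subgradient) auto
    then have "g1 z - g1 (y (Suc k)) - ereal (\<xi> \<bullet> (z - y (Suc k)))
        \<ge> ereal (\<mu>g / 2 * (norm (z - y (Suc k)))\<^sup>2)"
      using g1(5) by (simp add: strongly_convex_fun_def)
    moreover have "g1 z = ereal (g1r z)" "Gz = g1r z + g2 z"
      using that g1s g1y by (auto simp: \<psi>_def)
    ultimately show ?thesis
      using composite_ineq[OF g2, of "g1r (y (Suc k))" \<xi> z "y (Suc k)" \<mu>g "g1r z" "yb k"]
        g1y[of "Suc k"]
      by (simp add: \<xi> \<psi>_def inner_add_left inner_diff_left del: transpose_matrix_vector)
  qed

  \<comment> \<open>Monotonicity of the energy\<close>
  define E where "E k = (t k)\<^sup>2 * \<Delta> k + (1 / \<alpha>) / 2 * (norm (u k - xs))\<^sup>2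
    + (t (Suc k))\<^sup>2 / \<beta> / 2 * (norm (v k - ys))\<^sup>2 + 1 / (2 * \<gamma>) * (norm (l k - ls))\<^sup>2" for k
  have E_step: "E (Suc k) \<le> E k" if k: "k \<ge> 1" for k
  proof -
    let ?t = "t (Suc k)"
    have "?t\<^sup>2 * \<phi> (x (Suc k)) - ?t * (?t - 1) * \<phi> (x k) - ?t * \<phi> xs
        \<le> ?t * ((transpose A *v lb k) \<bullet> (xs - u (Suc k)))
          + (1 / \<alpha>) / 2 * ((norm (u k - xs))\<^sup>2 - (norm (u (Suc k) - xs))\<^sup>2)
          - (1 / \<alpha> - Lf2) / 2 * (norm (u (Suc k) - u k))\<^sup>2
          - 0 * ?t / 2 * (norm (u (Suc k) - xs))\<^sup>2"
      by (rule accelerated_step[OF tk(2)[OF k] order_refl u_step[OF k] u_diff[OF k] f_ineq[OF k]])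
    moreover have "0 \<le> (1 / \<alpha> - Lf2) / 2 * (norm (u (Suc k) - u k))\<^sup>2"
      using \<alpha>_Lf2 by simp
    ultimately have x_step: "?t\<^sup>2 * \<phi> (x (Suc k)) - ?t * (?t - 1) * \<phi> (x k) - ?t * \<phi> xs
        \<le> ?t * ((transpose A *v lb k) \<bullet> (xs - u (Suc k)))
          + (1 / \<alpha>) / 2 * ((norm (u k - xs))\<^sup>2 - (norm (u (Suc k) - xs))\<^sup>2)"
      by linarith
    note y_step = accelerated_step[OF tk(2)[OF k] less_imp_le[OF g1(4)] v_step[OF k] v_diff[OF k]
        g_ineq[OF k]]
    have "?t\<^sup>2 * \<Delta> (Suc k) + (1 / \<alpha>) / 2 * (norm (u (Suc k) - xs))\<^sup>2
        + (?t\<^sup>2 / \<beta> + \<mu>g * ?t) / 2 * (norm (v (Suc k) - ys))\<^sup>2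
        + 1 / (2 * \<gamma>) * (norm (l (Suc k) - ls))\<^sup>2
      \<le> (?t\<^sup>2 - ?t) * \<Delta> k + (1 / \<alpha>) / 2 * (norm (u k - xs))\<^sup>2
        + ?t\<^sup>2 / \<beta> / 2 * (norm (v k - ys))\<^sup>2 + 1 / (2 * \<gamma>) * (norm (l k - ls))\<^sup>2"
      unfolding \<Delta>_def r_def
      by (rule primal_dual_step[OF params(3) x_step y_step u_step[OF k] v_step[OF k] lb_def
            l_step[OF k] feas step_size[unfolded N_def]]) simp_all
    \<comment> \<open>The first growth condition, usable because the gap at a saddle point is
      nonnegative.\<close>
    moreover have "(?t\<^sup>2 - ?t) * \<Delta> k \<le> (t k)\<^sup>2 * \<Delta> k"
      using t_step1 k by (intro mult_right_mono \<Delta>_nonneg) auto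
    \<comment> \<open>The second growth condition: the gain from strong convexity pays for the
      larger weight of the distance to \<open>ys\<close> in the next energy.\<close>
    moreover have "(t (Suc (Suc k)))\<^sup>2 / \<beta> / 2 * (norm (v (Suc k) - ys))\<^sup>2
        \<le> (?t\<^sup>2 / \<beta> + \<mu>g * ?t) / 2 * (norm (v (Suc k) - ys))\<^sup>2"
      using t_step2[rule_format, of "Suc k"] params(2)
      by (intro mult_right_mono divide_right_mono) (simp_all add: field_simps)
    ultimately show ?thesis
      unfolding E_def by linarith
  qed
  have E1: "E 1 = E1"
    unfolding E1_eq E_def L_gap[OF order_refl] x_init(2) y_init(2) Suc_1
    by (simp add: mult.commute[of 2])
  have E_le: "E k \<le> E1" if "k \<ge> 1" for k
    using that
  proof (induction k rule: dec_induct)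
    case (step k)
    then show ?case
      using E_step by (metis order_trans)
  qed (use E1 in simp)
  have gap: "(t k)\<^sup>2 * \<Delta> k \<le> E1" and mult: "norm (l k - ls) \<le> sqrt (2 * \<gamma> * E1)"
    if "k \<ge> 1" for k
  proof -
    \<comment> \<open>As all summands of the energy are nonnegative, each of them is bounded by
      \<open>E1\<close> separately.\<close>
    have nonneg: "0 \<le> (t k)\<^sup>2 * \<Delta> k" "0 \<le> (1 / \<alpha>) / 2 * (norm (u k - xs))\<^sup>2"
      "0 \<le> (t (Suc k))\<^sup>2 / \<beta> / 2 * (norm (v k - ys))\<^sup>2" "0 \<le> 1 / (2 * \<gamma>) * (norm (l k - ls))\<^sup>2"
      using params \<Delta>_nonneg[OF that] by simp_all
    then show "(t k)\<^sup>2 * \<Delta> k \<le> E1"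
      using E_le[OF that] unfolding E_def by linarith
    have "1 / (2 * \<gamma>) * (norm (l k - ls))\<^sup>2 \<le> E1"
      using nonneg E_le[OF that] unfolding E_def by linarith
    then show "norm (l k - ls) \<le> sqrt (2 * \<gamma> * E1)"
      using params(3) by (intro real_le_rsqrt) (simp add: field_simps)
  qed

  \<comment> \<open>Residual bound and convergence rates\<close>
  have l_diff: "l (Suc k) - l k
      = \<gamma> *\<^sub>R ((t (Suc k))\<^sup>2 *\<^sub>R r (Suc k) - ((t (Suc k))\<^sup>2 - t (Suc k)) *\<^sub>R r k)" if "k \<ge> 1" for k
    unfolding l_step[OF that] u_step[OF that] v_step[OF that] r_def
    by (simp add: algebra_simps matrix_vector_mult_scaleR power2_eq_square)
  have "norm (l k - l 1) \<le> norm (l 1 - ls) + sqrt (2 * \<gamma> * E1)" if "k \<ge> 1" for k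
    using mult[OF that] norm_triangle_ineq4[of "l k - ls" "l 1 - ls"] by simp
  then have "(t k)\<^sup>2 * norm (r k)
      \<le> 2 * ((t 1)\<^sup>2 * norm (r 1) + (norm (l 1 - ls) + sqrt (2 * \<gamma> * E1)) / \<gamma>)" if "k \<ge> 1" for k
    using t_ge t_step1 l_diff params(3) that by (intro multiplier_residual_bound) auto
  \<comment> \<open>The coefficient 2 of the initial residual is relaxed to 3; the remaining terms
    agree.\<close>
  moreover have "2 * ((t 1)\<^sup>2 * norm (r 1) + (norm (l 1 - ls) + sqrt (2 * \<gamma> * E1)) / \<gamma>) \<le> C2"
    unfolding C2_eq r_def by (simp add: add_divide_distrib)
  ultimately have res: "(t k)\<^sup>2 * norm (r k) \<le> C2" if "k \<ge> 1" for k
    using that order_trans by blast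

  show ?thesis
  proof (intro allI impI conjI)
    fix k :: nat
    assume k: "k \<ge> 1"
    have t_pos: "(t k)\<^sup>2 > 0"
      using tk(1)[OF k] by (intro zero_less_power) simp
    show "\<L> (x k) (y k) ls - \<L> xs ys ls \<le> ereal (E1 / (t k)\<^sup>2)"
      using gap[OF k] t_pos unfolding L_gap[OF k] by (simp add: field_simps)
    show "norm (A *v x k + B *v y k - b) \<le> C2 / (t k)\<^sup>2"
      using res[OF k] t_pos unfolding r_def by (simp add: field_simps)
    \<comment> \<open>The objective difference is \<open>\<Delta> k\<close> minus
      \<open>ls \<bullet> r k\<close>, so its rate follows from those of the gap and of the
      residual.\<close>
    have "\<bar>\<phi> (x k) + \<psi> (y k) - \<phi> xs - \<psi> ys\<bar> \<le> \<Delta> k + norm ls * norm (r k)"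
      using Cauchy_Schwarz_ineq2[of ls "r k"] \<Delta>_nonneg[OF k] unfolding \<Delta>_def by linarith
    then have "(t k)\<^sup>2 * \<bar>\<phi> (x k) + \<psi> (y k) - \<phi> xs - \<psi> ys\<bar>
        \<le> (t k)\<^sup>2 * (\<Delta> k + norm ls * norm (r k))"
      by (intro mult_left_mono) auto
    also have "\<dots> \<le> E1 + C2 * norm ls"
      using gap[OF k] mult_right_mono[OF res[OF k] norm_ge_zero[of ls]]
      by (simp add: algebra_simps)
    finally have "\<bar>\<phi> (x k) + \<psi> (y k) - \<phi> xs - \<psi> ys\<bar> \<le> (E1 + C2 * norm ls) / (t k)\<^sup>2"
      using t_pos by (simp add: field_simps)
    then show "\<bar>f (x k) + g (y k) - f xs - g ys\<bar> \<le> ereal ((E1 + C2 * norm ls) / (t k)\<^sup>2)"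
      unfolding f_eq g_eq f1x[OF k] g1y[OF k] f1s g1s by (simp add: \<phi>_def \<psi>_def)
  qed
qed

end
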